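(* Let $(e,d)$ be a pair of coprime positive integers, $n=e+d$, let $\mathfrak p=\mathfrak p_e$ be the $e$-th parabolic subalgebra of $\mathfrak{sl}_n(k)$, and let $J=J_{(e,d)}$. Then the pairing $$\omega_J:\mathfrak p\times\mathfrak p\to k,\qquad(a,b)\mapsto\mathrm{tr}(J^t\cdot[a,b])$$ is non-degenerate. In other words, $\mathfrak p$ is a Frobenius Lie algebra and $l_J:\mathfrak p\to k$, $a\mapsto\mathrm{tr}(J^t\cdot a)$, is a Frobenius functional on $\mathfrak p$.
   Context: $k$ is an algebraically closed field of characteristic zero. $\mathfrak p_e=\Bigl\{\begin{pmatrix}A&B\\0&C\end{pmatrix}: A\in\mathrm{Mat}_{e\times e}(k),B\in\mathrm{Mat}_{e\times d}(k),C\in\mathrm{Mat}_{d\times d}(k),\ \mathrm{tr}(A)+\mathrm{tr}(C)=0\Bigr\}$. A finite dimensional Lie algebra $\mathfrak f$ over $k$ is Frobenius if there is a functional $\hat l\in\mathfrak f^*$ (a Frobenius functional) such that the skew-symmetric form $(a,b)\mapsto\hat l([a,b])$ on $\mathfrak f$ is non-degenerate. **The matrix $J_{(e,d)}$.** Put $J_{(1,1)}=\begin{pmatrix}0&1\\0&0\end{pmatrix}$. If $J_{(a,b)}=\begin{pmatrix}A_1&A_2\\0&A_3\end{pmatrix}$ with $A_1$ of size $a\times a$ and $A_3$ of size $b\times b$, then $$J_{(a,a+b)}=\begin{pmatrix}0&\mathbb 1&0\\0&A_1&A_2\\0&0&A_3\end{pmatrix},\qquad J_{(a+b,b)}=\begin{pmatrix}A_1&A_2&0\\0&A_3&\mathbb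 1\\0&0&0\end{pmatrix}.$$ Every coprime pair $(e,d)$ of positive integers is reached from $(1,1)$ by a unique sequence of steps $(a,b)\to(a,a+b)$ or $(a,b)\to(a+b,b)$; this defines $J_{(e,d)}\in\mathrm{Mat}_{n\times n}(k)$. *)

theory Defs
  imports "Jordan_Normal_Form.VS_Connect"
begin

section \<open>Lie algebras, Frobenius Lie algebras\<close>

record ('a, 'b) lie_algebra = "('a, 'b) module" +
  lie_bracket :: "'b \<Rightarrow> 'b \<Rightarrow> 'b"

locale lie_algebra = vectorspace K L
  for K :: "('a, 'r) ring_scheme" and L :: "('a, 'b, 'm) lie_algebra_scheme" (structure) +
  assumes bracket_closed:
      "\<lbrakk>x \<in> carrier L; y \<in> carrier L\<rbrakk> \<Longrightarrow> lie_bracket L x y \<in> carrier L"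
    and bracket_add_left:
      "\<lbrakk>x \<in> carrier L; y \<in> carrier L; z \<in> carrier L\<rbrakk> \<Longrightarrow>
        lie_bracket L (x \<oplus>\<^bsub>L\<^esub> y) z = lie_bracket L x z \<oplus>\<^bsub>L\<^esub> lie_bracket L y z"
    and bracket_add_right:
      "\<lbrakk>x \<in> carrier L; y \<in> carrier L; z \<in> carrier L\<rbrakk> \<Longrightarrow>
        lie_bracket L x (y \<oplus>\<^bsub>L\<^esub> z) = lie_bracket L x y \<oplus>\<^bsub>L\<^esub> lie_bracket L x z"
    and bracket_smult_left:
      "\<lbrakk>c \<in> carrier K; x \<in> carrier L; y \<in> carrier L\<rbrakk> \<Longrightarrow>
        lie_bracket L (c \<odot>\<^bsub>L\<^esub> x) y = c \<odot>\<^bsub>L\<^esub> lie_bracket L x y"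
    and bracket_smult_right:
      "\<lbrakk>c \<in> carrier K; x \<in> carrier L; y \<in> carrier L\<rbrakk> \<Longrightarrow>
        lie_bracket L x (c \<odot>\<^bsub>L\<^esub> y) = c \<odot>\<^bsub>L\<^esub> lie_bracket L x y"
    and bracket_self: "x \<in> carrier L \<Longrightarrow> lie_bracket L x x = \<zero>\<^bsub>L\<^esub>"
    and jacobi:
      "\<lbrakk>x \<in> carrier L; y \<in> carrier L; z \<in> carrier L\<rbrakk> \<Longrightarrow>
        lie_bracket L x (lie_bracket L y z) \<oplus>\<^bsub>L\<^esub> lie_bracket L y (lie_bracket L z x)
          \<oplus>\<^bsub>L\<^esub> lie_bracket L z (lie_bracket L x y) = \<zero>\<^bsub>L\<^esub>"

definition linear_functional ::
  "('a, 'r) ring_scheme \<Rightarrow> ('a, 'b, 'm) module_scheme \<Rightarrow> ('b \<Rightarrow> 'a) \<Rightarrow> bool" where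
  "linear_functional K V l \<longleftrightarrow>
     l \<in> carrier V \<rightarrow> carrier K \<and>
     (\<forall>x\<in>carrier V. \<forall>y\<in>carrier V. l (x \<oplus>\<^bsub>V\<^esub> y) = l x \<oplus>\<^bsub>K\<^esub> l y) \<and>
     (\<forall>c\<in>carrier K. \<forall>x\<in>carrier V. l (c \<odot>\<^bsub>V\<^esub> x) = c \<otimes>\<^bsub>K\<^esub> l x)"

definition nondegenerate ::
  "('a, 'r) ring_scheme \<Rightarrow> ('a, 'b, 'm) module_scheme \<Rightarrow> ('b \<Rightarrow> 'b \<Rightarrow> 'a) \<Rightarrow> bool" where
  "nondegenerate K V \<omega> \<longleftrightarrow>
     (\<forall>x\<in>carrier V. (\<forall>y\<in>carrier V. \<omega> x y = \<zero>\<^bsub>K\<^esub>) \<longrightarrow> x = \<zero>\<^bsub>V\<^esub>) \<and>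
     (\<forall>y\<in>carrier V. (\<forall>x\<in>carrier V. \<omega> x y = \<zero>\<^bsub>K\<^esub>) \<longrightarrow> y = \<zero>\<^bsub>V\<^esub>)"

definition frobenius_functional ::
  "('a, 'r) ring_scheme \<Rightarrow> ('a, 'b, 'm) lie_algebra_scheme \<Rightarrow> ('b \<Rightarrow> 'a) \<Rightarrow> bool" where
  "frobenius_functional K L l \<longleftrightarrow>
     linear_functional K L l \<and> nondegenerate K L (\<lambda>a b. l (lie_bracket L a b))"

definition frobenius_lie_algebra ::
  "('a, 'r) ring_scheme \<Rightarrow> ('a, 'b, 'm) lie_algebra_scheme \<Rightarrow> bool" where
  "frobenius_lie_algebra K L \<longleftrightarrow>
     lie_algebra K L \<and> vectorspace.fin_dim K L \<and> (\<exists>l. frobenius_functional K L l)"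


section \<open>The parabolic subalgebras of the special linear Lie algebra\<close>

definition trace :: "'a::comm_monoid_add mat \<Rightarrow> 'a" where
  "trace A = (\<Sum>i<dim_row A. A $$ (i, i))"

definition sl :: "nat \<Rightarrow> ('a::field, 'a mat) lie_algebra" where
  "sl n = module.extend
     (module_mat TYPE('a) n n\<lparr>carrier := {A \<in> carrier_mat n n. trace A = 0}\<rparr>)
     \<lparr>lie_bracket = (\<lambda>A B. A * B - B * A)\<rparr>"

definition parabolic :: "nat \<Rightarrow> nat \<Rightarrow> ('a::field, 'a mat) lie_algebra" where
  "parabolic e d = sl (e + d)\<lparr>carrier :=
     {four_block_mat A B (0\<^sub>m d e) C | A B C.
        A \<in> carrier_mat e e \<and> B \<in> carrier_mat e d \<and> C \<in> carrier_mat d d \<and>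
        trace A + trace C = 0}\<rparr>"


section \<open>The matrix $J_{(e,d)}$\<close>

text \<open>
  The steps are written with the whole matrix $M = J_{(a,b)}$ in place of its blocks
  $A_1$, $A_2$, $0$, $A_3$: the two steps border $M$ by the block row $(0\ 1\ 0)$ on the top,
  respectively by the block column $(0\ 1\ 0)^t$ on the right, and by zeros elsewhere. Blocks with no rows or no
  columns serve to juxtapose two matrices.
\<close>

definition J_step_top :: "nat \<Rightarrow> nat \<Rightarrow> 'a::{zero,one} mat \<Rightarrow> 'a mat" where
  "J_step_top a b M =
     four_block_mat (0\<^sub>m a a) (four_block_mat (1\<^sub>m a) (0\<^sub>m a b) (0\<^sub>m 0 a) (0\<^sub>m 0 b))
                    (0\<^sub>m (a + b) a) M"

definition J_step_right :: "nat \<Rightarrow> nat \<Rightarrow> 'a::{zero,one} mat \<Rightarrow> 'a mat" where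
  "J_step_right a b M =
     four_block_mat M (four_block_mat (0\<^sub>m a b) (0\<^sub>m a 0) (1\<^sub>m b) (0\<^sub>m b 0))
                    (0\<^sub>m b (a + b)) (0\<^sub>m b b)"

text \<open>
  The last step leading to $(e,d)$ is from $(e,d-e)$ if $e < d$ and from $(e-d,d)$ if $d < e$.
  The value is meaningful for coprime positive $e$, $d$ only.
\<close>

fun J_mat :: "nat \<Rightarrow> nat \<Rightarrow> 'a::{zero,one} mat" where
  "J_mat e d =
     (if e = 1 \<and> d = 1 then four_block_mat (0\<^sub>m 1 1) (1\<^sub>m 1) (0\<^sub>m 1 1) (0\<^sub>m 1 1)
      else if 0 < e \<and> e < d then J_step_top e (d - e) (J_mat e (d - e))
      else if 0 < d \<and> d < e then J_step_right (e - d) d (J_mat (e - d) d)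
      else undefined)"

declare J_mat.simps [simp del]

lemma J_mat_1_1: "J_mat 1 1 = four_block_mat (0\<^sub>m 1 1) (1\<^sub>m 1) (0\<^sub>m 1 1) (0\<^sub>m 1 1)"
  by (subst J_mat.simps) simp

lemma J_mat_top: "a > 0 \<Longrightarrow> b > 0 \<Longrightarrow> J_mat a (a + b) = J_step_top a b (J_mat a b)"
  by (subst J_mat.simps) simp

lemma J_mat_right: "a > 0 \<Longrightarrow> b > 0 \<Longrightarrow> J_mat (a + b) b = J_step_right a b (J_mat a b)"
  by (subst J_mat.simps) simp

text \<open>
  $J_{(e,d)}$ always has the block form assumed in its recursive definition.
\<close>

lemma J_mat_block_form:
  assumes "e > 0" "d > 0" "coprime e d"
  shows "\<exists>A1 \<in> carrier_mat e e. \<exists>A2 \<in> carrier_mat e d. \<exists>A3 \<in> carrier_mat d d.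
           (J_mat e d :: 'a::{zero,one} mat) = four_block_mat A1 A2 (0\<^sub>m d e) A3"
  using assms
proof (induction e d rule: J_mat.induct)
  case (1 e d)
  consider "e = 1 \<and> d = 1" | "e < d" | "d < e"
    using "1.prems" by (metis coprime_self nat_dvd_1_iff_1 linorder_neqE_nat)
  then show ?case
  proof cases
    case 1
    then have "J_mat e d = (four_block_mat (0\<^sub>m e e) (1\<^sub>m d) (0\<^sub>m d e) (0\<^sub>m d d) :: 'a mat)"
      using J_mat_1_1 by simp
    with 1 show ?thesis
      by - (rule bexI[of _ "0\<^sub>m e e"], rule bexI[of _ "1\<^sub>m d"], rule bexI[of _ "0\<^sub>m d d"], auto)
  next
    case 2
    define b where "b = d - e"
    have d: "d = e + b" "b > 0" using 2 b_def by auto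
    have "coprime e b" using "1.prems" d by (simp add: coprime_iff_gcd_eq_1)
    then obtain A1 A2 A3 :: "'a mat" where A: "A1 \<in> carrier_mat e e" "A2 \<in> carrier_mat e b"
        "A3 \<in> carrier_mat b b" "J_mat e b = four_block_mat A1 A2 (0\<^sub>m b e) A3"
      using "1.IH"(1)[folded b_def] "1.prems"(1) 2 d(2) by fastforce
    define R :: "'a mat" where
      "R = four_block_mat (1\<^sub>m e) (0\<^sub>m e b) (0\<^sub>m 0 e) (0\<^sub>m 0 b)"
    have "R \<in> carrier_mat (e + 0) (e + b)"
      unfolding R_def by (rule four_block_carrier_mat) auto
    then have "R \<in> carrier_mat e d" by (simp add: d(1))
    moreover have "(J_mat e b :: 'a mat) \<in> carrier_mat d d"
      using A(1,3) by (auto simp: d(1) A(4))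
    moreover have "J_mat e d = four_block_mat (0\<^sub>m e e) R (0\<^sub>m d e) (J_mat e b)"
      using J_mat_top[OF "1.prems"(1) d(2), where ?'a = 'a]
      by (simp only: J_step_top_def R_def d(1))
    ultimately show ?thesis
      by - (rule bexI[of _ "0\<^sub>m e e"], rule bexI[of _ R], rule bexI[of _ "J_mat e b"], auto)
  next
    case 3
    define a where "a = e - d"
    have e: "e = a + d" "a > 0" using 3 a_def by auto
    have "coprime a d" using "1.prems" e by (simp add: coprime_iff_gcd_eq_1)
    then obtain A1 A2 A3 :: "'a mat" where A: "A1 \<in> carrier_mat a a" "A2 \<in> carrier_mat a d"
        "A3 \<in> carrier_mat d d" "J_mat a d = four_block_mat A1 A2 (0\<^sub>m d a) A3"
      using "1.IH"(2)[folded a_def] "1.prems"(2) 3 e(2) by fastforce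
    define R :: "'a mat" where
      "R = four_block_mat (0\<^sub>m a d) (0\<^sub>m a 0) (1\<^sub>m d) (0\<^sub>m d 0)"
    have "R \<in> carrier_mat (a + d) (d + 0)"
      unfolding R_def by (rule four_block_carrier_mat) auto
    then have "R \<in> carrier_mat e d" by (simp add: e(1))
    moreover have "(J_mat a d :: 'a mat) \<in> carrier_mat e e"
      using A(1,3) by (auto simp: e(1) A(4))
    moreover have "J_mat e d = four_block_mat (J_mat a d) R (0\<^sub>m d e) (0\<^sub>m d d)"
      using J_mat_right[OF e(2) "1.prems"(2), where ?'a = 'a]
      by (simp only: J_step_right_def R_def e(1))
    ultimately show ?thesis
      by - (rule bexI[of _ "J_mat a d"], rule bexI[of _ R], rule bexI[of _ "0\<^sub>m d d"], auto)
  qed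
qed

text \<open>The three-by-three block form of the two steps.\<close>

lemma J_step_top_blocks:
  assumes "A1 \<in> carrier_mat a a" "A2 \<in> carrier_mat a b" "A3 \<in> carrier_mat b b"
  shows "J_step_top a b (four_block_mat A1 A2 (0\<^sub>m b a) A3) =
    mat (a + a + b) (a + a + b) (\<lambda>(i, j).
      if i < a then (if j < a then 0 else if j < a + a then 1\<^sub>m a $$ (i, j - a) else 0)
      else if i < a + a then
        (if j < a then 0 else if j < a + a then A1 $$ (i - a, j - a)
         else A2 $$ (i - a, j - a - a))
      else
        (if j < a then 0 else if j < a + a then 0 else A3 $$ (i - a - a, j - a - a)))"
  using assms by (intro eq_matI) (auto simp: J_step_top_def)

lemma J_step_right_blocks:
  assumes "A1 \<in> carrier_mat a a" "A2 \<in> carrier_mat a b" "A3 \<in> carrier_mat b b"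
  shows "J_step_right a b (four_block_mat A1 A2 (0\<^sub>m b a) A3) =
    mat (a + b + b) (a + b + b) (\<lambda>(i, j).
      if i < a then (if j < a then A1 $$ (i, j) else if j < a + b then A2 $$ (i, j - a) else 0)
      else if i < a + b then
        (if j < a then 0 else if j < a + b then A3 $$ (i - a, j - a)
         else 1\<^sub>m b $$ (i - a, j - a - b))
      else 0)"
  using assms by (intro eq_matI) (auto simp: J_step_right_def)

end

theory Submission
  imports Defs
begin

text \<open>
  Write $P$ for the block upper triangular matrices of size $n = e + d$ and $N \<subseteq> P$ for those
  concentrated in the upper right block. The trace form on all $n \times n$ matrices identifies
  $N$ with the orthogonal complement of $P$. Since
  $\mathrm{tr}(J^t [a, b]) = \mathrm{tr}([J^t, a] b)$, and since every matrix of $P$ is a traceless one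
  plus a scalar matrix, which pairs to $\mathrm{tr}\,[J^t, a] = 0$, an element $a$ of the radical of the
  form satisfies $[J^t, a] \<in> N$. So the theorem reduces to
  a statement on $P$ in which traces no longer occur (\<open>J_mat_centraliser\<close>): if $a \<in> P$ and
  $[J^t, a] \<in> N$, then $a$ is scalar. A traceless scalar matrix vanishes in characteristic zero.

  The reduced statement goes by induction along the construction of $J$. For $J$ with diagonal blocks
  $A_1, A_3$ and upper right block $A_2$, and $a$ with blocks $X, Z$ and $Y$, the condition
  $[J^t, a] \<in> N$ amounts to three equations
  (\<open>commutator_upper_right_blocks\<close>). When $J = J_{(a, a + b)}$ comes from $M = J_{(a, b)}$, they say
  that the first $a$ columns of $Y$ vanish, that $Z$ is block upper triangular for $(a, b)$ with upper
  left block $X$, and that $[M^t, Z]$ is, up to sign, the rest of $Y$ placed in the upper right block.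
  Thus $Z$ satisfies the hypothesis for $M$; once $Z$ is known to be scalar, $Y$ vanishes and $X$ is the
  same scalar. The other step exchanges the roles of $X$ and $Z$.
\<close>

section \<open>Block upper triangular matrices\<close>

definition block_upper :: "nat \<Rightarrow> nat \<Rightarrow> 'a::zero mat set" where
  "block_upper e d = {A \<in> carrier_mat (e + d) (e + d). \<forall>i<e + d. \<forall>j<e. e \<le> i \<longrightarrow> A $$ (i, j) = 0}"

text \<open>
  This is the nilradical of the block upper triangular matrices, and also their orthogonal complement
  with respect to the trace form; \<open>upper_rightI_trace\<close> is the inclusion that matters.
\<close>

definition upper_right :: "nat \<Rightarrow> nat \<Rightarrow> 'a::zero mat set" where
  "upper_right e d =
     {A \<in> carrier_mat (e + d) (e + d). \<forall>i<e + d. \<forall>j<e + d. e \<le> i \<or> j < e \<longrightarrow> A $$ (i, j) = 0}"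

lemma block_upperE:
  assumes "A \<in> block_upper e d"
  obtains X Y Z where "X \<in> carrier_mat e e" "Y \<in> carrier_mat e d" "Z \<in> carrier_mat d d"
    "A = four_block_mat X Y (0\<^sub>m d e) Z"
proof -
  obtain X Y W Z where s: "split_block A e e = (X, Y, W, Z)"
    by (metis prod_cases4)
  have dim: "dim_row A = e + d" "dim_col A = e + d"
    using assms by (auto simp: block_upper_def)
  note sb = split_block[OF s dim]
  have "W $$ (i, j) = 0" if "i < d" "j < e" for i j
  proof -
    have "A $$ (e + i, j) = 0"
      using assms that by (simp add: block_upper_def)
    moreover have "A $$ (e + i, j) = W $$ (i, j)"
      using sb that by (subst sb(5)) auto
    ultimately show ?thesis by simp
  qed
  then have "W = 0\<^sub>m d e"
    using sb(3) by (intro eq_matI) auto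
  with sb that show thesis by blast
qed

lemma block_upperI:
  assumes "X \<in> carrier_mat e e" "Z \<in> carrier_mat d d"
  shows "four_block_mat X Y (0\<^sub>m d e) Z \<in> block_upper e d"
  using assms by (auto simp: block_upper_def)

lemma upper_right_block:
  assumes "A \<in> carrier_mat e e" "B \<in> carrier_mat e d" "C \<in> carrier_mat d e" "D \<in> carrier_mat d d"
    "four_block_mat A B C D \<in> upper_right e d"
  shows "A = 0\<^sub>m e e" "C = 0\<^sub>m d e" "D = 0\<^sub>m d d"
proof -
  let ?F = "four_block_mat A B C D"
  have z: "?F $$ (i, j) = 0" if "i < e + d" "j < e + d" "e \<le> i \<or> j < e" for i j
    using assms(5) that unfolding upper_right_def by blast
  show "A = 0\<^sub>m e e"
  proof (rule eq_matI)
    fix i j assume "i < dim_row (0\<^sub>m e e)" "j < dim_col (0\<^sub>m e e)"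
    then show "A $$ (i, j) = 0\<^sub>m e e $$ (i, j)" using assms(1-4) z[of i j] by auto
  qed (use assms in auto)
  show "C = 0\<^sub>m d e"
  proof (rule eq_matI)
    fix i j assume "i < dim_row (0\<^sub>m d e)" "j < dim_col (0\<^sub>m d e)"
    then show "C $$ (i, j) = 0\<^sub>m d e $$ (i, j)" using assms(1-4) z[of "e + i" j] by auto
  qed (use assms in auto)
  show "D = 0\<^sub>m d d"
  proof (rule eq_matI)
    fix i j assume "i < dim_row (0\<^sub>m d d)" "j < dim_col (0\<^sub>m d d)"
    then show "D $$ (i, j) = 0\<^sub>m d d $$ (i, j)" using assms(1-4) z[of "e + i" "e + j"] by auto
  qed (use assms in auto)
qed

lemma minus_eq_zero_mat:
  fixes A B :: "'a::group_add mat"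
  assumes "A \<in> carrier_mat m n" "B \<in> carrier_mat m n" "A - B = 0\<^sub>m m n"
  shows "A = B"
proof (rule eq_matI)
  fix i j assume "i < dim_row B" "j < dim_col B"
  moreover from this have "(A - B) $$ (i, j) = 0" using assms(2,3) by simp
  ultimately show "A $$ (i, j) = B $$ (i, j)" by simp
qed (use assms in auto)

section \<open>Commuting with a block upper triangular matrix modulo the nilradical\<close>

lemma minus_four_block_mat:
  assumes "A1 \<in> carrier_mat nr1 nc1" "B1 \<in> carrier_mat nr1 nc2"
    "C1 \<in> carrier_mat nr2 nc1" "D1 \<in> carrier_mat nr2 nc2"
    "A2 \<in> carrier_mat nr1 nc1" "B2 \<in> carrier_mat nr1 nc2"
    "C2 \<in> carrier_mat nr2 nc1" "D2 \<in> carrier_mat nr2 nc2"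
  shows "four_block_mat A1 B1 C1 D1 - four_block_mat A2 B2 C2 D2 =
    four_block_mat (A1 - A2) (B1 - B2) (C1 - C2) (D1 - D2)"
  using assms by (intro eq_matI) auto

text \<open>
  The three equations are the vanishing of the two diagonal blocks and of the lower left block of the
  commutator. They are what makes the induction possible: when $A_2$ consists of an identity block and
  a zero block, multiplication by $A_2^t$ only inserts or deletes zero rows and columns.
\<close>

lemma commutator_upper_right_blocks:
  fixes A1 :: "'a::comm_ring_1 mat"
  assumes A: "A1 \<in> carrier_mat e e" "A2 \<in> carrier_mat e d" "A3 \<in> carrier_mat d d"
    and X: "X \<in> carrier_mat e e" "Y \<in> carrier_mat e d" "Z \<in> carrier_mat d d"
    and J: "J = four_block_mat A1 A2 (0\<^sub>m d e) A3"
    and a: "a = four_block_mat X Y (0\<^sub>m d e) Z"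
    and comm: "J\<^sup>T * a - a * J\<^sup>T \<in> upper_right e d"
  shows "A1\<^sup>T * X = X * A1\<^sup>T + Y * A2\<^sup>T" "A2\<^sup>T * X = Z * A2\<^sup>T"
    "A2\<^sup>T * Y + A3\<^sup>T * Z = Z * A3\<^sup>T"
proof -
  have JT: "J\<^sup>T = four_block_mat (A1\<^sup>T) (0\<^sub>m e d) (A2\<^sup>T) (A3\<^sup>T)"
    unfolding J using A by (subst transpose_four_block_mat) auto
  note [simp] = A X
  note AT = A[THEN transpose_carrier_mat[THEN iffD2]]
  have m: "A1\<^sup>T * X \<in> carrier_mat e e" "A1\<^sup>T * Y \<in> carrier_mat e d" "A2\<^sup>T * X \<in> carrier_mat d e"
    "Y * A3\<^sup>T \<in> carrier_mat e d" "Z * A3\<^sup>T \<in> carrier_mat d d" "Z * A2\<^sup>T \<in> carrier_mat d e"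
    by (fact mult_carrier_mat[OF AT(1) X(1)] mult_carrier_mat[OF AT(1) X(2)] mult_carrier_mat[OF AT(2) X(1)]
        mult_carrier_mat[OF X(2) AT(3)] mult_carrier_mat[OF X(3) AT(3)] mult_carrier_mat[OF X(3) AT(2)])+
  have p1: "J\<^sup>T * a = four_block_mat (A1\<^sup>T * X) (A1\<^sup>T * Y) (A2\<^sup>T * X) (A2\<^sup>T * Y + A3\<^sup>T * Z)"
    unfolding JT a by (subst mult_four_block_mat[of _ e e _ d _ d _ _ e _ d])
      (auto simp: m left_mult_zero_mat[OF X(3)] right_mult_zero_mat[of "A3\<^sup>T" d d])
  have p2: "a * J\<^sup>T = four_block_mat (X * A1\<^sup>T + Y * A2\<^sup>T) (Y * A3\<^sup>T) (Z * A2\<^sup>T) (Z * A3\<^sup>T)"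
    unfolding JT a by (subst mult_four_block_mat[of _ e e _ d _ d _ _ e _ d])
      (auto simp: m left_mult_zero_mat[OF X(3)] right_mult_zero_mat[OF X(1)] left_mult_zero_mat[OF AT(1)])
  have diff: "J\<^sup>T * a - a * J\<^sup>T = four_block_mat (A1\<^sup>T * X - (X * A1\<^sup>T + Y * A2\<^sup>T)) (A1\<^sup>T * Y - Y * A3\<^sup>T)
      (A2\<^sup>T * X - Z * A2\<^sup>T) (A2\<^sup>T * Y + A3\<^sup>T * Z - Z * A3\<^sup>T)"
    unfolding p1 p2
    by (rule minus_four_block_mat[of _ e e _ d _ d]; intro add_carrier_mat m)
       (use mult_carrier_mat[OF X(1) AT(1)] mult_carrier_mat[OF X(2) AT(2)] mult_carrier_mat[OF AT(2) X(2)]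
        mult_carrier_mat[OF AT(3) X(3)] in auto)
  have c: "A1\<^sup>T * X - (X * A1\<^sup>T + Y * A2\<^sup>T) \<in> carrier_mat e e"
    "A1\<^sup>T * Y - Y * A3\<^sup>T \<in> carrier_mat e d" "A2\<^sup>T * X - Z * A2\<^sup>T \<in> carrier_mat d e"
    "A2\<^sup>T * Y + A3\<^sup>T * Z - Z * A3\<^sup>T \<in> carrier_mat d d"
    by (intro minus_carrier_mat add_carrier_mat m mult_carrier_mat[OF X(2) AT(2)])+
  note * = upper_right_block[OF c comm[unfolded diff]]
  show "A1\<^sup>T * X = X * A1\<^sup>T + Y * A2\<^sup>T" "A2\<^sup>T * X = Z * A2\<^sup>T"
    "A2\<^sup>T * Y + A3\<^sup>T * Z = Z * A3\<^sup>T"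
    by (rule minus_eq_zero_mat[OF _ _ *(1)] minus_eq_zero_mat[OF _ _ *(2)] minus_eq_zero_mat[OF _ _ *(3)];
        intro m add_carrier_mat mult_carrier_mat[OF X(1) AT(1)] mult_carrier_mat[OF X(2) AT(2)]
          mult_carrier_mat[OF AT(3) X(3)])+
qed

section \<open>The trace form\<close>

lemma trace_smult_one: "trace (c \<cdot>\<^sub>m 1\<^sub>m n) = of_nat n * (c::'a::comm_semiring_1)"
  by (simp add: trace_def)

lemma trace_mult_comm:
  fixes A :: "'a::comm_semiring_0 mat"
  assumes "A \<in> carrier_mat m n" "B \<in> carrier_mat n m"
  shows "trace (A * B) = trace (B * A)"
proof -
  have "trace (A * B) = (\<Sum>i<m. \<Sum>k<n. A $$ (i, k) * B $$ (k, i))"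
    using assms by (auto simp: trace_def scalar_prod_def atLeast0LessThan intro!: sum.cong)
  also have "\<dots> = (\<Sum>k<n. \<Sum>i<m. B $$ (k, i) * A $$ (i, k))"
    by (subst sum.swap) (simp add: mult.commute)
  also have "\<dots> = trace (B * A)"
    using assms by (auto simp: trace_def scalar_prod_def atLeast0LessThan intro!: sum.cong)
  finally show ?thesis .
qed

lemma trace_add:
  assumes "A \<in> carrier_mat n n" "B \<in> carrier_mat n n"
  shows "trace (A + B) = trace A + trace B"
  using assms by (simp add: trace_def sum.distrib)

lemma trace_diff:
  fixes A :: "'a::ab_group_add mat"
  assumes "A \<in> carrier_mat n n" "B \<in> carrier_mat n n"
  shows "trace (A - B) = trace A - trace B"
  using assms by (simp add: trace_def sum_subtractf)

lemma trace_smult: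
  fixes c :: "'a::comm_semiring_1"
  assumes "A \<in> carrier_mat n n"
  shows "trace (c \<cdot>\<^sub>m A) = c * trace A"
  using assms by (simp add: trace_def sum_distrib_left)

definition mat_unit :: "nat \<Rightarrow> nat \<Rightarrow> nat \<Rightarrow> 'a::zero_neq_one mat" where
  "mat_unit n i j = mat n n (\<lambda>(k, l). if k = i \<and> l = j then 1 else 0)"

lemma trace_mult_mat_unit:
  fixes M :: "'a::comm_semiring_1 mat"
  assumes "M \<in> carrier_mat n n" "i < n" "j < n"
  shows "trace (M * mat_unit n i j) = M $$ (j, i)"
proof -
  have "trace (M * mat_unit n i j) = (\<Sum>k<n. \<Sum>l<n. M $$ (k, l) * (if l = i \<and> k = j then 1 else 0))"
    using assms by (auto simp: trace_def scalar_prod_def mat_unit_def atLeast0LessThan intro!: sum.cong)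
  also have "\<dots> = (\<Sum>k<n. if k = j then M $$ (k, i) else 0)"
  proof (intro sum.cong refl)
    fix k
    have "(\<Sum>l<n. M $$ (k, l) * (if l = i \<and> k = j then 1 else 0)) =
        (\<Sum>l<n. if l = i then (if k = j then M $$ (k, i) else 0) else 0)"
      by (intro sum.cong) auto
    then show "(\<Sum>l<n. M $$ (k, l) * (if l = i \<and> k = j then 1 else 0)) = (if k = j then M $$ (k, i) else 0)"
      using assms(2) by simp
  qed
  also have "\<dots> = M $$ (j, i)"
    using assms(3) by simp
  finally show ?thesis .
qed

text \<open>
  Testing against matrix units is enough: the one with its entry in row $j$ and column $i$ reads off the
  entry of $M$ in row $i$ and column $j$, and it is block upper triangular unless that position
  lies in the upper right block.
\<close>

lemma upper_rightI_trace:
  fixes M :: "'a::comm_ring_1 mat"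
  assumes M: "M \<in> carrier_mat (e + d) (e + d)"
    and tr: "\<And>B. B \<in> block_upper e d \<Longrightarrow> trace (M * B) = 0"
  shows "M \<in> upper_right e d"
proof -
  have "M $$ (i, j) = 0" if "i < e + d" "j < e + d" "e \<le> i \<or> j < e" for i j
  proof -
    have "(mat_unit (e + d) j i :: 'a mat) \<in> block_upper e d"
      using that by (auto simp: block_upper_def mat_unit_def)
    from tr[OF this] show ?thesis
      using that by (simp add: trace_mult_mat_unit[OF M])
  qed
  with M show ?thesis by (simp add: upper_right_def)
qed

section \<open>Scalar centralisers along the recursion for $J$\<close>

lemma commutator_smult_one:
  fixes M :: "'a::comm_ring_1 mat"
  assumes "M \<in> carrier_mat n n"
  shows "M * (c \<cdot>\<^sub>m 1\<^sub>m n) - (c \<cdot>\<^sub>m 1\<^sub>m n) * M = 0\<^sub>m n n"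
proof -
  have "M * (c \<cdot>\<^sub>m 1\<^sub>m n) = c \<cdot>\<^sub>m M" "(c \<cdot>\<^sub>m 1\<^sub>m n) * M = c \<cdot>\<^sub>m M"
    using assms by (simp_all add: mult_smult_distrib[OF assms one_carrier_mat] mult_smult_assoc_mat[OF one_carrier_mat])
  then show ?thesis using assms by simp
qed

text \<open>
  Let $A$ have diagonal blocks $X, Z$ and upper right block $Y$, and let $R = (1\ 0)$ be the upper right
  block of the new matrix. Multiplying by $R^t$ on the left appends zero rows and on the right keeps
  only the first $a$ columns. So $R^t X = Z R^t$ says that $X$ is the upper left block of $Z$ above zeros,
  and $Y R^t = 0$ makes $R^t Y$ an element of the nilradical for $(a, b)$; the third block equation
  then hands $Z$ to the induction hypothesis.
\<close>

lemma centraliser_step_top: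
  fixes M :: "'a::comm_ring_1 mat"
  assumes M: "M \<in> carrier_mat (a + b) (a + b)"
    and IH: "\<And>A. A \<in> block_upper a b \<Longrightarrow> M\<^sup>T * A - A * M\<^sup>T \<in> upper_right a b \<Longrightarrow>
               \<exists>c. A = c \<cdot>\<^sub>m 1\<^sub>m (a + b)"
    and A: "A \<in> block_upper a (a + b)"
    and comm: "(J_step_top a b M)\<^sup>T * A - A * (J_step_top a b M)\<^sup>T \<in> upper_right a (a + b)"
  shows "\<exists>c. A = c \<cdot>\<^sub>m 1\<^sub>m (a + (a + b))"
proof -
  define R :: "'a mat" where "R = four_block_mat (1\<^sub>m a) (0\<^sub>m a b) (0\<^sub>m 0 a) (0\<^sub>m 0 b)"
  have R: "R \<in> carrier_mat a (a + b)"
    using four_block_carrier_mat[of "1\<^sub>m a" a a "0\<^sub>m 0 b" 0 b] by (simp add: R_def)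
  have R_index: "R $$ (i, j) = (if i = j then 1 else 0)" if "i < a" "j < a + b" for i j
    using that by (auto simp: R_def)
  from A obtain X Y Z where X: "X \<in> carrier_mat a a" and Y: "Y \<in> carrier_mat a (a + b)"
    and Z: "Z \<in> carrier_mat (a + b) (a + b)" and A_eq: "A = four_block_mat X Y (0\<^sub>m (a + b) a) Z"
    by (rule block_upperE)
  have J: "J_step_top a b M = four_block_mat (0\<^sub>m a a) R (0\<^sub>m (a + b) a) M"
    by (simp add: J_step_top_def R_def)
  note blocks = commutator_upper_right_blocks[OF zero_carrier_mat R M X Y Z J A_eq comm]
  have left: "(R\<^sup>T * B) $$ (i, j) = (if i < a then B $$ (i, j) else 0)"
    if "B \<in> carrier_mat a n" "i < a + b" "j < n" for B i j n
  proof -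
    have "(R\<^sup>T * B) $$ (i, j) = (\<Sum>k<a. (if k = i then 1 else 0) * B $$ (k, j))"
      using that R by (auto simp: scalar_prod_def atLeast0LessThan R_index intro!: sum.cong)
    also have "\<dots> = (\<Sum>k<a. if k = i then B $$ (k, j) else 0)"
      by (intro sum.cong) auto
    finally show ?thesis by simp
  qed
  have right: "(B * R\<^sup>T) $$ (i, j) = B $$ (i, j)"
    if "B \<in> carrier_mat n (a + b)" "i < n" "j < a" for B i j n
  proof -
    have "(B * R\<^sup>T) $$ (i, j) = (\<Sum>k<a + b. B $$ (i, k) * (if j = k then 1 else 0))"
      using that R by (auto simp: scalar_prod_def atLeast0LessThan R_index intro!: sum.cong)
    also have "\<dots> = (\<Sum>k<a + b. if j = k then B $$ (i, k) else 0)"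
      by (intro sum.cong) auto
    finally show ?thesis using that by simp
  qed
  have Y0: "Y $$ (i, j) = 0" if "i < a" "j < a" for i j
  proof -
    have "Y * R\<^sup>T = 0\<^sub>m a a"
      using blocks(1) X Y R by simp
    then have "(Y * R\<^sup>T) $$ (i, j) = 0" using that by simp
    then show ?thesis using right[OF Y that] by simp
  qed
  have ZX: "Z $$ (i, j) = (if i < a then X $$ (i, j) else 0)" if "i < a + b" "j < a" for i j
    using left[OF X that] right[OF Z that] blocks(2) by simp
  have comm_MZ: "(M\<^sup>T * Z - Z * M\<^sup>T) $$ (i, j) = - (if i < a then Y $$ (i, j) else 0)"
    if "i < a + b" "j < a + b" for i j
  proof -
    have "(Z * M\<^sup>T) $$ (i, j) = (R\<^sup>T * Y) $$ (i, j) + (M\<^sup>T * Z) $$ (i, j)"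
      unfolding blocks(3)[symmetric] using that M R Y Z by auto
    then have "(Z * M\<^sup>T) $$ (i, j) = (if i < a then Y $$ (i, j) else 0) + (M\<^sup>T * Z) $$ (i, j)"
      using left[OF Y that] by simp
    moreover have "(M\<^sup>T * Z - Z * M\<^sup>T) $$ (i, j) = (M\<^sup>T * Z) $$ (i, j) - (Z * M\<^sup>T) $$ (i, j)"
      using that M Z by simp
    ultimately show ?thesis by (simp only:) simp
  qed
  have "Z \<in> block_upper a b"
    using Z ZX by (auto simp: block_upper_def)
  moreover have "M\<^sup>T * Z - Z * M\<^sup>T \<in> upper_right a b"
  proof -
    have "M\<^sup>T * Z - Z * M\<^sup>T \<in> carrier_mat (a + b) (a + b)"
      using M Z by (intro minus_carrier_mat mult_carrier_mat) auto
    then show ?thesis using Y0 comm_MZ by (auto simp: upper_right_def)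
  qed
  ultimately obtain c where c: "Z = c \<cdot>\<^sub>m 1\<^sub>m (a + b)" using IH by blast
  \<comment> \<open>The scalar matrix $Z$ commutes with $M^t$, and the defect of commutation was $Y$.\<close>
  have "Y $$ (i, j) = 0" if "i < a" "j < a + b" for i j
    using comm_MZ[of i j] commutator_smult_one[of "M\<^sup>T" "a + b" c] M that unfolding c by simp
  moreover have "X $$ (i, j) = (if i = j then c else 0)" if "i < a" "j < a" for i j
    using ZX[of i j] that unfolding c by (auto split: if_splits)
  ultimately have "A = c \<cdot>\<^sub>m 1\<^sub>m (a + (a + b))"
    unfolding A_eq c using X Y by (intro eq_matI) auto
  then show ?thesis ..
qed

text \<open>
  The mirror image of the previous step, with $X$ inheriting the hypothesis in place of $Z$. Now
  the upper right block is $R = (0\ 1)^t$: multiplying by $R^t$ on the left keeps only the last $b$ rows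
  and on the right puts $a$ zero columns in front.
\<close>

lemma centraliser_step_right:
  fixes M :: "'a::comm_ring_1 mat"
  assumes M: "M \<in> carrier_mat (a + b) (a + b)"
    and IH: "\<And>A. A \<in> block_upper a b \<Longrightarrow> M\<^sup>T * A - A * M\<^sup>T \<in> upper_right a b \<Longrightarrow>
               \<exists>c. A = c \<cdot>\<^sub>m 1\<^sub>m (a + b)"
    and A: "A \<in> block_upper (a + b) b"
    and comm: "(J_step_right a b M)\<^sup>T * A - A * (J_step_right a b M)\<^sup>T \<in> upper_right (a + b) b"
  shows "\<exists>c. A = c \<cdot>\<^sub>m 1\<^sub>m (a + b + b)"
proof -
  define R :: "'a mat" where "R = four_block_mat (0\<^sub>m a b) (0\<^sub>m a 0) (1\<^sub>m b) (0\<^sub>m b 0)"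
  have R: "R \<in> carrier_mat (a + b) b"
    using four_block_carrier_mat[of "0\<^sub>m a b" a b "0\<^sub>m b 0" b 0] by (simp add: R_def)
  have R_index: "R $$ (i, j) = (if i = a + j then 1 else 0)" if "i < a + b" "j < b" for i j
    using that by (auto simp: R_def)
  from A obtain X Y Z where X: "X \<in> carrier_mat (a + b) (a + b)" and Y: "Y \<in> carrier_mat (a + b) b"
    and Z: "Z \<in> carrier_mat b b" and A_eq: "A = four_block_mat X Y (0\<^sub>m b (a + b)) Z"
    by (rule block_upperE)
  have J: "J_step_right a b M = four_block_mat M R (0\<^sub>m b (a + b)) (0\<^sub>m b b)"
    by (simp add: J_step_right_def R_def)
  note blocks = commutator_upper_right_blocks[OF M R zero_carrier_mat X Y Z J A_eq comm]
  have left: "(R\<^sup>T * B) $$ (i, j) = B $$ (a + i, j)"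
    if "B \<in> carrier_mat (a + b) n" "i < b" "j < n" for B i j n
  proof -
    have "(R\<^sup>T * B) $$ (i, j) = (\<Sum>k<a + b. (if k = a + i then 1 else 0) * B $$ (k, j))"
      using that R by (auto simp: scalar_prod_def atLeast0LessThan R_index intro!: sum.cong)
    also have "\<dots> = (\<Sum>k<a + b. if k = a + i then B $$ (k, j) else 0)"
      by (intro sum.cong) auto
    finally show ?thesis using that by simp
  qed
  have right: "(B * R\<^sup>T) $$ (i, j) = (if a \<le> j then B $$ (i, j - a) else 0)"
    if "B \<in> carrier_mat n b" "i < n" "j < a + b" for B i j n
  proof -
    have "(B * R\<^sup>T) $$ (i, j) = (\<Sum>k<b. B $$ (i, k) * (if j = a + k then 1 else 0))"
      using that R by (auto simp: scalar_prod_def atLeast0LessThan R_index intro!: sum.cong)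
    also have "\<dots> = (\<Sum>k<b. if k = j - a then (if a \<le> j then B $$ (i, k) else 0) else 0)"
      by (intro sum.cong) auto
    finally show ?thesis using that by auto
  qed
  have Y0: "Y $$ (i, j) = 0" if "a \<le> i" "i < a + b" "j < b" for i j
  proof -
    have "R\<^sup>T * Y = 0\<^sub>m b b"
      using blocks(3) Z Y R by simp
    then have "(R\<^sup>T * Y) $$ (i - a, j) = 0" using that by simp
    then show ?thesis using left[OF Y, of "i - a" j] that by simp
  qed
  have XZ: "X $$ (a + i, j) = (if a \<le> j then Z $$ (i, j - a) else 0)" if "i < b" "j < a + b" for i j
    using left[OF X that] right[OF Z that] blocks(2) by simp
  have comm_MX: "(M\<^sup>T * X - X * M\<^sup>T) $$ (i, j) = (if a \<le> j then Y $$ (i, j - a) else 0)"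
    if "i < a + b" "j < a + b" for i j
  proof -
    have "(M\<^sup>T * X) $$ (i, j) = (X * M\<^sup>T) $$ (i, j) + (Y * R\<^sup>T) $$ (i, j)"
      unfolding blocks(1) using that M R X Y by auto
    then have "(M\<^sup>T * X) $$ (i, j) = (X * M\<^sup>T) $$ (i, j) + (if a \<le> j then Y $$ (i, j - a) else 0)"
      using right[OF Y that] by simp
    moreover have "(M\<^sup>T * X - X * M\<^sup>T) $$ (i, j) = (M\<^sup>T * X) $$ (i, j) - (X * M\<^sup>T) $$ (i, j)"
      using that M X by simp
    ultimately show ?thesis by (simp only:) simp
  qed
  have "X \<in> block_upper a b"
  proof -
    have "X $$ (i, j) = 0" if "a \<le> i" "i < a + b" "j < a" for i j
      using XZ[of "i - a" j] that by simp
    with X show ?thesis by (auto simp: block_upper_def)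
  qed
  moreover have "M\<^sup>T * X - X * M\<^sup>T \<in> upper_right a b"
  proof -
    have "M\<^sup>T * X - X * M\<^sup>T \<in> carrier_mat (a + b) (a + b)"
      using M X by (intro minus_carrier_mat mult_carrier_mat) auto
    then show ?thesis using Y0 comm_MX by (auto simp: upper_right_def)
  qed
  ultimately obtain c where c: "X = c \<cdot>\<^sub>m 1\<^sub>m (a + b)" using IH by blast
  \<comment> \<open>The scalar matrix $X$ commutes with $M^t$, and the defect of commutation was $Y$.\<close>
  have "Y $$ (i, j) = 0" if "i < a + b" "j < b" for i j
    using comm_MX[of i "a + j"] commutator_smult_one[of "M\<^sup>T" "a + b" c] M that unfolding c by simp
  moreover have "Z $$ (i, j) = (if i = j then c else 0)" if "i < b" "j < b" for i j
    using XZ[of i "a + j"] that unfolding c by (auto split: if_splits)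
  ultimately have "A = c \<cdot>\<^sub>m 1\<^sub>m (a + b + b)"
    unfolding A_eq c using Z Y by (intro eq_matI) auto
  then show ?thesis ..
qed

lemma J_mat_carrier:
  assumes "0 < e" "0 < d" "coprime e d"
  shows "J_mat e d \<in> carrier_mat (e + d) (e + d)"
  using J_mat_block_form[OF assms] by (metis four_block_carrier_mat)

text \<open>
  The trace of $A$ is arbitrary here: in the induction the hypothesis is passed on to a
  diagonal block of $A$, and the blocks of a traceless matrix need not be traceless.
\<close>

lemma J_mat_centraliser:
  fixes A :: "'a::comm_ring_1 mat"
  assumes "0 < e" "0 < d" "coprime e d" "A \<in> block_upper e d"
    and "(J_mat e d)\<^sup>T * A - A * (J_mat e d)\<^sup>T \<in> upper_right e d"
  shows "\<exists>c. A = c \<cdot>\<^sub>m 1\<^sub>m (e + d)"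
  using assms
proof (induction "e + d" arbitrary: e d A rule: less_induct)
  case less
  consider "e = 1" "d = 1" | "e < d" | "d < e"
    using less.prems(3) by (metis coprime_self nat_dvd_1_iff_1 linorder_neqE_nat)
  then show ?case
  proof cases
    case 1
    from less.prems(4) obtain X Y Z where X: "X \<in> carrier_mat 1 1" and Y: "Y \<in> carrier_mat 1 1"
      and Z: "Z \<in> carrier_mat 1 1" and A_eq: "A = four_block_mat X Y (0\<^sub>m 1 1) Z"
      unfolding 1 by (rule block_upperE)
    note blocks = commutator_upper_right_blocks[OF zero_carrier_mat one_carrier_mat zero_carrier_mat
        X Y Z J_mat_1_1 A_eq less.prems(5)[unfolded 1]]
    have "X = Z" "Y = 0\<^sub>m 1 1"
      using blocks X Y Z by simp_all
    then have "A = X $$ (0, 0) \<cdot>\<^sub>m 1\<^sub>m (1 + 1)"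
      unfolding A_eq using X by (intro eq_matI) auto
    then show ?thesis unfolding 1 ..
  next
    case 2
    define b where "b = d - e"
    have d: "d = e + b" "0 < b" using 2 by (auto simp: b_def)
    have cop: "coprime e b" using less.prems(3) d by (simp add: coprime_iff_gcd_eq_1)
    show ?thesis
      using less.prems(4,5) unfolding d(1) J_mat_top[OF less.prems(1) d(2)]
      by (intro centraliser_step_top[OF J_mat_carrier[OF less.prems(1) d(2) cop]])
        (use less.prems(1) d cop in \<open>auto intro!: less.hyps\<close>)
  next
    case 3
    define a where "a = e - d"
    have e: "e = a + d" "0 < a" using 3 by (auto simp: a_def)
    have cop: "coprime a d" using less.prems(3) e by (simp add: coprime_iff_gcd_eq_1)
    show ?thesis
      using less.prems(4,5) unfolding e(1) J_mat_right[OF e(2) less.prems(2)]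
      by (intro centraliser_step_right[OF J_mat_carrier[OF e(2) less.prems(2) cop]])
        (use less.prems(2) e cop in \<open>auto intro!: less.hyps\<close>)
  qed
qed

section \<open>The parabolic subalgebra as a finite-dimensional Lie algebra\<close>

lemma trace_four_block:
  assumes "X \<in> carrier_mat e e" "Z \<in> carrier_mat d d"
  shows "trace (four_block_mat X Y W Z) = trace X + trace Z"
proof -
  have split: "{..<e + d} = {..<e} \<union> {e..<e + d}" "{e..<e + d} = (\<lambda>i. e + i) ` {..<d}"
    by auto (metis add_diff_inverse_nat add_less_cancel_left image_eqI lessThan_iff not_less)
  have "trace (four_block_mat X Y W Z) =
      (\<Sum>i<e. four_block_mat X Y W Z $$ (i, i)) + (\<Sum>i\<in>{e..<e + d}. four_block_mat X Y W Z $$ (i, i))"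
    using assms unfolding trace_def by (simp add: split(1)) (subst sum.union_disjoint; auto)
  then show ?thesis
    using assms by (simp add: trace_def split(2) sum.reindex)
qed

lemma parabolic_carrier:
  "carrier (parabolic e d :: ('a::field, 'a mat) lie_algebra) = {A \<in> block_upper e d. trace A = 0}"
  (is "?L = ?R")
proof
  show "?L \<subseteq> ?R"
    by (auto simp: parabolic_def trace_four_block intro!: block_upperI)
  show "?R \<subseteq> ?L"
  proof
    fix A :: "'a mat" assume A: "A \<in> ?R"
    then obtain X Y Z where "X \<in> carrier_mat e e" "Y \<in> carrier_mat e d" "Z \<in> carrier_mat d d"
      "A = four_block_mat X Y (0\<^sub>m d e) Z" by (auto elim: block_upperE)
    moreover from this A have "trace X + trace Z = 0" by (simp add: trace_four_block)
    ultimately show "A \<in> ?L" by (auto simp: parabolic_def)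
  qed
qed

lemma parabolic_ops:
  fixes L :: "('a::field, 'a mat) lie_algebra"
  assumes "L = parabolic e d"
  shows "add L = (+)" "zero L = 0\<^sub>m (e + d) (e + d)" "smult L = (\<cdot>\<^sub>m)"
    "lie_bracket L = (\<lambda>A B. A * B - B * A)"
  by (simp_all add: assms parabolic_def sl_def module.defs module_mat_simps)

lemma block_upper_carrier: "A \<in> block_upper e d \<Longrightarrow> A \<in> carrier_mat (e + d) (e + d)"
  by (simp add: block_upper_def)

lemma block_upper_closed:
  fixes A B :: "'a::comm_ring_1 mat"
  assumes A: "A \<in> block_upper e d" and B: "B \<in> block_upper e d"
  shows "A + B \<in> block_upper e d" "A - B \<in> block_upper e d" "c \<cdot>\<^sub>m A \<in> block_upper e d"
    "A * B \<in> block_upper e d"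
proof -
  show "A + B \<in> block_upper e d" "c \<cdot>\<^sub>m A \<in> block_upper e d"
    using A B by (auto simp: block_upper_def)
  show "A - B \<in> block_upper e d"
    using A B by (auto simp: block_upper_def intro!: minus_carrier_mat)
  have "(A * B) $$ (i, j) = 0" if "i < e + d" "j < e" "e \<le> i" for i j
  proof -
    have "A $$ (i, k) * B $$ (k, j) = 0" if "k < e + d" for k
      using A B that \<open>i < e + d\<close> \<open>j < e\<close> \<open>e \<le> i\<close> by (cases "k < e") (auto simp: block_upper_def)
    then show ?thesis
      using that block_upper_carrier[OF A] block_upper_carrier[OF B] by (simp add: scalar_prod_def)
  qed
  then show "A * B \<in> block_upper e d"
    using block_upper_carrier[OF A] block_upper_carrier[OF B] by (auto simp: block_upper_def)
qed

lemma one_block_upper: "1\<^sub>m (e + d) \<in> block_upper e d"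
  by (auto simp: block_upper_def)

lemma trace_commutator:
  fixes A B :: "'a::comm_ring_1 mat"
  assumes "A \<in> carrier_mat n n" "B \<in> carrier_mat n n"
  shows "trace (A * B - B * A) = 0"
  using assms trace_mult_comm[OF assms] by (simp add: trace_diff[of _ n])

lemma parabolic_vectorspace:
  "vectorspace class_ring (parabolic e d :: ('a::field, 'a mat) lie_algebra)"
proof -
  let ?L = "parabolic e d :: ('a, 'a mat) lie_algebra"
  note simps = parabolic_ops[OF refl] parabolic_carrier
  have grp: "abelian_group ?L"
  proof (rule abelian_groupI)
    fix A assume A: "A \<in> carrier ?L"
    show "\<exists>B\<in>carrier ?L. B \<oplus>\<^bsub>?L\<^esub> A = \<zero>\<^bsub>?L\<^esub>"
    proof
      show "(-1) \<cdot>\<^sub>m A \<in> carrier ?L"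
        using A block_upper_carrier[of A e d]
        by (auto simp: simps trace_smult[of _ "e + d"] intro!: block_upper_closed(3))
      show "(-1) \<cdot>\<^sub>m A \<oplus>\<^bsub>?L\<^esub> A = \<zero>\<^bsub>?L\<^esub>"
        using A block_upper_carrier[of A e d] by (auto simp: simps intro!: eq_matI)
    qed
  qed (auto simp: simps block_upper_closed trace_add[OF block_upper_carrier block_upper_carrier]
      comm_add_mat[OF block_upper_carrier block_upper_carrier]
      assoc_add_mat[OF block_upper_carrier block_upper_carrier block_upper_carrier]
      left_add_zero_mat[OF block_upper_carrier] block_upper_def trace_def)
  have "module class_ring ?L"
  proof (rule moduleI)
    show "cring (class_ring :: 'a ring)" using class_field[where ?'a = 'a] by (simp add: field_def domain_def)
  qed (auto simp: grp simps class_ring_simps block_upper_closed trace_smult[OF block_upper_carrier]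
      add_smult_distrib_left_mat[OF block_upper_carrier block_upper_carrier]
      add_smult_distrib_right_mat[OF block_upper_carrier])
  then show ?thesis
    by (simp add: vectorspace_def class_field)
qed

text \<open>
  Once the brackets are expanded, the six triple products of the three matrices cancel in pairs; the
  products are then treated as opaque matrices, which leaves an identity of abelian groups.
\<close>

lemma mat_jacobi:
  fixes X Y Z :: "'a::comm_ring_1 mat"
  assumes [simp]: "X \<in> carrier_mat n n" "Y \<in> carrier_mat n n" "Z \<in> carrier_mat n n"
  shows "X * (Y * Z - Z * Y) - (Y * Z - Z * Y) * X + (Y * (Z * X - X * Z) - (Z * X - X * Z) * Y)
    + (Z * (X * Y - Y * X) - (X * Y - Y * X) * Z) = 0\<^sub>m n n"
proof -
  have expand: "A * (B * C - C * B) - (B * C - C * B) * A = A * B * C - A * C * B - (B * C * A - C * B * A)"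
    and prod: "A * B * C \<in> carrier_mat n n"
    if [simp]: "A \<in> carrier_mat n n" "B \<in> carrier_mat n n" "C \<in> carrier_mat n n" for A B C :: "'a mat"
  proof -
    have BC: "B * C \<in> carrier_mat n n" and CB: "C * B \<in> carrier_mat n n"
      by (auto intro: mult_carrier_mat[of _ n n])
    have "A * (B * C - C * B) = A * B * C - A * C * B"
      by (simp add: mult_minus_distrib_mat[OF _ BC CB, of A n] assoc_mult_mat[of A n n _ n _ n])
    moreover have "(B * C - C * B) * A = B * C * A - C * B * A"
      by (rule minus_mult_distrib_mat[OF BC CB, of A n]) simp
    ultimately show "A * (B * C - C * B) - (B * C - C * B) * A =
        A * B * C - A * C * B - (B * C * A - C * B * A)"
      by simp
    show "A * B * C \<in> carrier_mat n n"
      using mult_carrier_mat[OF mult_carrier_mat[OF that(1,2)] that(3)] .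
  qed
  have cancel: "P1 - P2 - (P3 - P4) + (P3 - P5 - (P6 - P2)) + (P6 - P4 - (P1 - P5)) = 0\<^sub>m n n"
    if "P1 \<in> carrier_mat n n" "P2 \<in> carrier_mat n n" "P3 \<in> carrier_mat n n"
      "P4 \<in> carrier_mat n n" "P5 \<in> carrier_mat n n" "P6 \<in> carrier_mat n n" for P1 P2 P3 P4 P5 P6 :: "'a mat"
    using that by (intro eq_matI) auto
  show ?thesis
    unfolding expand[OF assms(1,2,3)] expand[OF assms(2,3,1)] expand[OF assms(3,1,2)]
    by (intro cancel prod assms)
qed

lemma parabolic_lie_algebra:
  "lie_algebra class_ring (parabolic e d :: ('a::field, 'a mat) lie_algebra)"
proof (intro lie_algebra.intro lie_algebra_axioms.intro parabolic_vectorspace)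
  let ?L = "parabolic e d :: ('a, 'a mat) lie_algebra"
  let ?n = "e + d"
  note simps = parabolic_ops[OF refl] parabolic_carrier
  note carr = block_upper_carrier[of _ e d]
  fix X Y Z :: "'a mat" and c :: 'a
  assume X: "X \<in> carrier ?L"
  then have X': "X \<in> block_upper e d" "X \<in> carrier_mat ?n ?n" by (auto simp: simps carr)
  show "lie_bracket ?L X X = \<zero>\<^bsub>?L\<^esub>"
    using mult_carrier_mat[OF X'(2) X'(2)] by (simp add: simps)
  assume Y: "Y \<in> carrier ?L"
  then have Y': "Y \<in> block_upper e d" "Y \<in> carrier_mat ?n ?n" by (auto simp: simps carr)
  note prod_XY = mult_carrier_mat[OF X'(2) Y'(2)] mult_carrier_mat[OF Y'(2) X'(2)]
  show "lie_bracket ?L X Y \<in> carrier ?L"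
    using X' Y' by (auto simp: simps trace_commutator intro!: block_upper_closed)
  show "lie_bracket ?L (c \<odot>\<^bsub>?L\<^esub> X) Y = c \<odot>\<^bsub>?L\<^esub> lie_bracket ?L X Y"
    "lie_bracket ?L X (c \<odot>\<^bsub>?L\<^esub> Y) = c \<odot>\<^bsub>?L\<^esub> lie_bracket ?L X Y"
    using prod_XY X'(2) Y'(2)
    by (auto simp: simps mult_smult_distrib[OF X'(2) Y'(2)] mult_smult_distrib[OF Y'(2) X'(2)]
        mult_smult_assoc_mat[OF X'(2) Y'(2)] mult_smult_assoc_mat[OF Y'(2) X'(2)] algebra_simps
        simp del: index_mult_mat(1) intro!: eq_matI)
  assume Z: "Z \<in> carrier ?L"
  then have Z': "Z \<in> block_upper e d" "Z \<in> carrier_mat ?n ?n" by (auto simp: simps carr)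
  note prods = prod_XY mult_carrier_mat[OF X'(2) Z'(2)] mult_carrier_mat[OF Y'(2) Z'(2)]
    mult_carrier_mat[OF Z'(2) X'(2)] mult_carrier_mat[OF Z'(2) Y'(2)]
  show "lie_bracket ?L (X \<oplus>\<^bsub>?L\<^esub> Y) Z = lie_bracket ?L X Z \<oplus>\<^bsub>?L\<^esub> lie_bracket ?L Y Z"
    "lie_bracket ?L X (Y \<oplus>\<^bsub>?L\<^esub> Z) = lie_bracket ?L X Y \<oplus>\<^bsub>?L\<^esub> lie_bracket ?L X Z"
    using prods X'(2) Y'(2) Z'(2)
    by (auto simp: simps add_mult_distrib_mat[OF X'(2) Y'(2) Z'(2)] mult_add_distrib_mat[OF Z'(2) X'(2) Y'(2)]
        add_mult_distrib_mat[OF Y'(2) Z'(2) X'(2)] mult_add_distrib_mat[OF X'(2) Y'(2) Z'(2)] algebra_simps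
        simp del: index_mult_mat(1) intro!: eq_matI)
  show "lie_bracket ?L X (lie_bracket ?L Y Z) \<oplus>\<^bsub>?L\<^esub> lie_bracket ?L Y (lie_bracket ?L Z X)
      \<oplus>\<^bsub>?L\<^esub> lie_bracket ?L Z (lie_bracket ?L X Y) = \<zero>\<^bsub>?L\<^esub>"
    using mat_jacobi[OF X'(2) Y'(2) Z'(2)] by (simp add: simps)
qed

text \<open>
  In characteristic zero, this is the projection onto the traceless matrices along the scalar ones. It
  maps the block upper triangular matrices onto the parabolic subalgebra.
\<close>

definition traceless :: "'a::field mat \<Rightarrow> 'a mat" where
  "traceless A = A - (trace A / of_nat (dim_row A)) \<cdot>\<^sub>m 1\<^sub>m (dim_row A)"

lemma trace_traceless:
  fixes A :: "'a::field_char_0 mat"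
  assumes "A \<in> carrier_mat n n"
  shows "trace (traceless A) = 0"
  using assms by (cases "n = 0") (auto simp: traceless_def trace_diff[of _ n] trace_smult_one trace_def sum_subtractf)

lemma traceless_parabolic:
  fixes A :: "'a::field_char_0 mat"
  assumes "A \<in> block_upper e d"
  shows "traceless A \<in> carrier (parabolic e d)"
proof -
  have "dim_row A = e + d" using block_upper_carrier[OF assms] by simp
  then have "traceless A \<in> block_upper e d"
    using assms by (auto simp: traceless_def intro!: block_upper_closed one_block_upper)
  then show ?thesis
    by (simp add: parabolic_carrier trace_traceless[OF block_upper_carrier[OF assms]])
qed

text \<open>
  The subalgebra is a linear image of the space of coordinate vectors of length $n^2$: read a vector as a
  matrix, row by row, clear its lower left block, and project onto the traceless matrices.
\<close>

lemma parabolic_fin_dim: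
  "vectorspace.fin_dim class_ring (parabolic e d :: ('a::field_char_0, 'a mat) lie_algebra)"
proof -
  let ?L = "parabolic e d :: ('a, 'a mat) lie_algebra"
  define n where "n = e + d"
  let ?V = "module_vec TYPE('a) (n * n)"
  note simps = parabolic_ops[OF refl, folded n_def] module_vec_simps
  define B :: "'a vec \<Rightarrow> 'a mat" where
    "B v = mat n n (\<lambda>(i, j). if e \<le> i \<and> j < e then 0 else v $ (i * n + j))" for v
  have idx: "i * n + j < n * n" if "i < n" "j < n" for i j
  proof -
    have "i * n + j < (i + 1) * n" using that by simp
    also have "\<dots> \<le> n * n" using that by (intro mult_right_mono) auto
    finally show ?thesis .
  qed
  have B: "B v \<in> block_upper e d" "B v \<in> carrier_mat n n" for v
    by (auto simp: B_def block_upper_def n_def)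
  have B_add: "B (v + w) = B v + B w" if "w \<in> carrier_vec (n * n)" for v w
    using that by (auto simp: B_def idx intro!: eq_matI)
  have B_smult: "B (c \<cdot>\<^sub>v v) = c \<cdot>\<^sub>m B v" if "v \<in> carrier_vec (n * n)" for c v
    using that by (auto simp: B_def idx intro!: eq_matI)
  have traceless_add: "traceless (P + Q) = traceless P + traceless Q"
    if "P \<in> carrier_mat n n" "Q \<in> carrier_mat n n" for P Q :: "'a mat"
    using that by (intro eq_matI) (auto simp: traceless_def trace_add[of _ n] add_divide_distrib algebra_simps)
  have traceless_smult: "traceless (c \<cdot>\<^sub>m P) = c \<cdot>\<^sub>m traceless P"
    if "P \<in> carrier_mat n n" for c and P :: "'a mat"
    using that by (intro eq_matI) (auto simp: traceless_def trace_smult[of _ n] algebra_simps)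
  have "(\<lambda>v. traceless (B v)) \<in> LinearCombinations.module_hom class_ring ?V ?L"
    unfolding LinearCombinations.module_hom_def simps
    using traceless_parabolic[OF B(1)]
    by (simp add: B_add B_smult traceless_add[OF B(2) B(2)] traceless_smult[OF B(2)])
  then have "linear_map class_ring ?V ?L (\<lambda>v. traceless (B v))"
    by (intro linear_map.intro mod_hom.intro mod_hom_axioms.intro vec_vs parabolic_vectorspace
        vectorspace.axioms(1))
  moreover have "(\<lambda>v. traceless (B v)) ` carrier ?V = carrier ?L"
  proof
    show "(\<lambda>v. traceless (B v)) ` carrier ?V \<subseteq> carrier ?L"
      using traceless_parabolic[OF B(1)] by auto
    show "carrier ?L \<subseteq> (\<lambda>v. traceless (B v)) ` carrier ?V"
    proof
      fix A assume "A \<in> carrier ?L"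
      then have A: "A \<in> block_upper e d" "trace A = 0" by (auto simp: parabolic_carrier)
      define v where "v = vec (n * n) (\<lambda>k. A $$ (k div n, k mod n))"
      have "B v = A"
      proof (rule eq_matI)
        fix i j assume "i < dim_row A" "j < dim_col A"
        then have "i < n" "j < n" using block_upper_carrier[OF A(1)] by (auto simp: n_def)
        moreover from this have "A $$ (i, j) = 0" if "e \<le> i" "j < e"
          using A(1) that by (simp add: block_upper_def n_def)
        ultimately show "B v $$ (i, j) = A $$ (i, j)"
          by (auto simp: B_def v_def idx)
      qed (use B(2)[of v] block_upper_carrier[OF A(1)] n_def in auto)
      moreover have "traceless A = A"
        using A block_upper_carrier[OF A(1)] by (auto simp: traceless_def intro!: eq_matI)
      moreover have "v \<in> carrier ?V" by (simp add: v_def module_vec_simps)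
      ultimately show "A \<in> (\<lambda>v. traceless (B v)) ` carrier ?V" by force
    qed
  qed
  ultimately show ?thesis
    by (rule linear_map.surj_fin_dim[OF _ vec_space.fin_dim])
qed

section \<open>Non-degeneracy of the form\<close>

lemma trace_commutator_pairing:
  fixes J A B :: "'a::comm_ring_1 mat"
  assumes J: "J \<in> carrier_mat n n" and A: "A \<in> carrier_mat n n" and B: "B \<in> carrier_mat n n"
  shows "trace (J\<^sup>T * (A * B - B * A)) = trace ((J\<^sup>T * A - A * J\<^sup>T) * B)"
proof -
  have JT: "J\<^sup>T \<in> carrier_mat n n" using J by simp
  note c = mult_carrier_mat[OF A B] mult_carrier_mat[OF B A] mult_carrier_mat[OF JT A]
    mult_carrier_mat[OF A JT] mult_carrier_mat[OF JT B]
  have "trace (J\<^sup>T * (A * B - B * A)) = trace (J\<^sup>T * (A * B)) - trace (J\<^sup>T * (B * A))"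
    using mult_carrier_mat[OF JT c(1)] mult_carrier_mat[OF JT c(2)]
    by (simp add: mult_minus_distrib_mat[OF JT c(1,2)] trace_diff[of _ n])
  also have "trace (J\<^sup>T * (B * A)) = trace (A * J\<^sup>T * B)"
    by (simp add: assoc_mult_mat[OF JT B A, symmetric] trace_mult_comm[OF c(5) A] assoc_mult_mat[OF A JT B])
  also have "trace (J\<^sup>T * (A * B)) - trace (A * J\<^sup>T * B) = trace ((J\<^sup>T * A - A * J\<^sup>T) * B)"
    using mult_carrier_mat[OF c(3) B] mult_carrier_mat[OF c(4) B]
    by (simp add: minus_mult_distrib_mat[OF c(3,4) B] trace_diff[of _ n] assoc_mult_mat[OF JT A B])
  finally show ?thesis .
qed

text \<open>
  The form only tests $[J^t, A]$ against traceless matrices $B$. As a commutator has trace zero, it is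
  also orthogonal to the scalar matrices, hence to all block upper triangular ones, so
  it lies in the nilradical and \<open>J_mat_centraliser\<close> applies.
\<close>

lemma J_mat_radical:
  fixes A :: "'a::field_char_0 mat"
  assumes pos: "0 < e" "0 < d" "coprime e d"
    and A: "A \<in> carrier (parabolic e d)"
    and rad: "\<And>B. B \<in> carrier (parabolic e d) \<Longrightarrow> trace ((J_mat e d)\<^sup>T * (A * B - B * A)) = 0"
  shows "A = 0\<^sub>m (e + d) (e + d)"
proof -
  let ?n = "e + d" and ?J = "J_mat e d :: 'a mat"
  let ?M = "?J\<^sup>T * A - A * ?J\<^sup>T"
  have A': "A \<in> block_upper e d" "trace A = 0" using A by (auto simp: parabolic_carrier)
  have c: "?J \<in> carrier_mat ?n ?n" "A \<in> carrier_mat ?n ?n"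
    using J_mat_carrier[OF pos] block_upper_carrier[OF A'(1)] by auto
  have M: "?M \<in> carrier_mat ?n ?n"
    using c by (intro minus_carrier_mat mult_carrier_mat) auto
  have trM: "trace ?M = 0"
    using c by (intro trace_commutator) auto
  have "?M \<in> upper_right e d"
  proof (rule upper_rightI_trace[OF M])
    fix B :: "'a mat" assume B: "B \<in> block_upper e d"
    define t where "t = trace B / of_nat ?n"
    have B_carr: "B \<in> carrier_mat ?n ?n" using B by (rule block_upper_carrier)
    have tB: "traceless B \<in> carrier (parabolic e d)" by (rule traceless_parabolic[OF B])
    then have tB_carr: "traceless B \<in> carrier_mat ?n ?n"
      by (auto simp: parabolic_carrier block_upper_carrier)
    have "B = traceless B + t \<cdot>\<^sub>m 1\<^sub>m ?n"
      using B_carr by (intro eq_matI) (auto simp: traceless_def t_def)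
    from arg_cong[OF this, of "(*) ?M"]
    have "?M * B = ?M * (traceless B + t \<cdot>\<^sub>m 1\<^sub>m ?n)" .
    also have "\<dots> = ?M * traceless B + t \<cdot>\<^sub>m ?M"
      using mult_add_distrib_mat[OF M tB_carr, of "t \<cdot>\<^sub>m 1\<^sub>m ?n"] mult_smult_distrib[OF M one_carrier_mat, of t]
      by (simp only: right_mult_one_mat[OF M] smult_carrier_mat one_carrier_mat)
    finally have "trace (?M * B) = trace (?M * traceless B) + t * trace ?M"
      using M mult_carrier_mat[OF M tB_carr] by (simp add: trace_add[of _ ?n] trace_smult[of _ ?n])
    also have "\<dots> = 0"
      using rad[OF tB] trM by (simp add: trace_commutator_pairing[OF c tB_carr])
    finally show "trace (?M * B) = 0" .
  qed
  then obtain k where k: "A = k \<cdot>\<^sub>m 1\<^sub>m ?n"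
    using J_mat_centraliser[OF pos A'(1)] by blast
  then have "of_nat ?n * k = 0" using A'(2) by (simp only: trace_smult_one)
  then have "k = 0" using pos(1) by (simp del: of_nat_add)
  then show ?thesis using k by (auto intro!: eq_matI)
qed

theorem theorem7p2:
  fixes e d :: nat
    and \<pp> :: "('k::{alg_closed_field, field_char_0}, 'k mat) lie_algebra"
    and J :: "'k mat"
  assumes "e > 0" and "d > 0" and "coprime e d"
    and "\<pp> = parabolic e d" and "J = J_mat e d"
  shows "nondegenerate class_ring \<pp> (\<lambda>a b. trace (J\<^sup>T * lie_bracket \<pp> a b)) \<and>
         frobenius_lie_algebra class_ring \<pp> \<and>
         frobenius_functional class_ring \<pp> (\<lambda>a. trace (J\<^sup>T * a))"
proof -
  let ?n = "e + d"
  note simps = parabolic_ops[OF assms(4)] class_ring_simps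
  have J: "J \<in> carrier_mat ?n ?n" "J\<^sup>T \<in> carrier_mat ?n ?n"
    using J_mat_carrier[OF assms(1-3)] assms(5) by auto
  have carr: "A \<in> carrier_mat ?n ?n" if "A \<in> carrier \<pp>" for A
    using that by (auto simp: assms(4) parabolic_carrier block_upper_carrier)
  have rad: "A = 0\<^sub>m ?n ?n"
    if "A \<in> carrier \<pp>" "\<And>B. B \<in> carrier \<pp> \<Longrightarrow> trace (J\<^sup>T * (A * B - B * A)) = 0" for A
    using that unfolding assms(4,5) by (rule J_mat_radical[OF assms(1-3)])
  have skew: "trace (J\<^sup>T * (A * B - B * A)) = - trace (J\<^sup>T * (B * A - A * B))"
    if "A \<in> carrier \<pp>" "B \<in> carrier \<pp>" for A B
  proof -
    note A = carr[OF that(1)] and B = carr[OF that(2)]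
    note c = mult_carrier_mat[OF A B] mult_carrier_mat[OF B A]
    note c' = mult_carrier_mat[OF J(2) c(1)] mult_carrier_mat[OF J(2) c(2)]
    show ?thesis
      by (simp add: mult_minus_distrib_mat[OF J(2) c] mult_minus_distrib_mat[OF J(2) c(2,1)]
          trace_diff[OF c'] trace_diff[OF c'(2,1)])
  qed
  have nondeg: "nondegenerate class_ring \<pp> (\<lambda>a b. trace (J\<^sup>T * lie_bracket \<pp> a b))"
    unfolding nondegenerate_def simps
  proof (intro conjI ballI impI)
    fix A assume "A \<in> carrier \<pp>" "\<forall>B\<in>carrier \<pp>. trace (J\<^sup>T * (A * B - B * A)) = 0"
    then show "A = 0\<^sub>m ?n ?n" by (intro rad) auto
  next
    fix A assume A: "A \<in> carrier \<pp>" "\<forall>B\<in>carrier \<pp>. trace (J\<^sup>T * (B * A - A * B)) = 0"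
    show "A = 0\<^sub>m ?n ?n"
      using A(2) by (intro rad[OF A(1)]) (simp add: skew[OF A(1)])
  qed
  have "linear_functional class_ring \<pp> (\<lambda>a. trace (J\<^sup>T * a))"
    unfolding linear_functional_def simps
  proof (intro conjI ballI)
    fix A B c assume A: "A \<in> carrier \<pp>" and B: "B \<in> carrier \<pp>"
    note c = mult_carrier_mat[OF J(2) carr[OF A]] mult_carrier_mat[OF J(2) carr[OF B]]
    show "trace (J\<^sup>T * (A + B)) = trace (J\<^sup>T * A) + trace (J\<^sup>T * B)"
      by (simp only: mult_add_distrib_mat[OF J(2) carr[OF A] carr[OF B]] trace_add[OF c])
    show "trace (J\<^sup>T * (c \<cdot>\<^sub>m A)) = c * trace (J\<^sup>T * A)"
      by (simp only: mult_smult_distrib[OF J(2) carr[OF A]] trace_smult[OF c(1)])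
  qed simp
  with nondeg have "frobenius_functional class_ring \<pp> (\<lambda>a. trace (J\<^sup>T * a))"
    by (simp add: frobenius_functional_def)
  moreover from this have "frobenius_lie_algebra class_ring \<pp>"
    unfolding frobenius_lie_algebra_def assms(4)
    by (intro conjI parabolic_lie_algebra parabolic_fin_dim exI)
  ultimately show ?thesis using nondeg by blast
qed

end
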